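(* The topological stable rank of the Bohl algebra $\mathrm{B}$ with respect to the topology of uniform convergence on $\mathbb{R}$ is infinite.
   Context: Let $\mathbb{N}=\{0,1,2,\dots\}$ and $\mathbb{N}^*=\{1,2,3,\dots\}$. The Bohl algebra $\mathrm{B}$ is the complex algebra of functions $\mathbb{R}\to\mathbb{C}$ given by $$\mathrm{B}:=\Big\{ t\mapsto\sum_{n=1}^N c_n t^{m_n} e^{\lambda_n t}: N\in \mathbb{N}^*,\; c_n, \lambda_n \in \mathbb{C}, \; m_n \in \mathbb{N}\Big\},$$ with pointwise addition, scalar multiplication and multiplication. The topology of uniform convergence on $\mathrm{B}$ is the one with basis of open sets $(V_{f,\epsilon})_{f\in \mathrm{B},\,\epsilon>0}$, where $V_{f, \epsilon}:=\{g \in \mathrm{B}: \|f-g\|_\infty:= \sup_{t\in \mathbb{R}} |f(t)-g(t)|<\epsilon\}$. (Functions in $\mathrm{B}$ may be unbounded.) Let $R$ be a commutative unital ring with $1\neq 0$, endowed with a topology $\mathcal{T}$ (not assumed to be compatible with the algebraic operations of $R$). For $n\in\mathbb{N}^*$, an $n$-tuple $(f_1,\dots,f_n)\in R^n$ is called invertible if there exists $(x_1,\dots,x_n)\in R^n$ with $\sum_{j=1}^n x_jf_j=1$; the set of all invertible $n$-tuples is denoted $U_n(R)$. The topological stable rank of $(R,\mathcal{T})$ is the least integer $n\geq 1$ for which $U_n(R)$ is dense in $R^n$ (with the product topology), or infinite if no such $n$ exists. *)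

theory Defs
  imports "HOL-Analysis.Analysis" "HOL-Algebra.Ring"
begin

definition bohl :: "(real \<Rightarrow> complex) set" where
  "bohl = {(\<lambda>t. \<Sum>n=1..N. c n * complex_of_real t ^ m n * exp (l n * complex_of_real t)) |
     (N :: nat) (c :: nat \<Rightarrow> complex) (m :: nat \<Rightarrow> nat) (l :: nat \<Rightarrow> complex). N \<ge> 1}"

definition bohl_ring :: "(real \<Rightarrow> complex) ring" where
  "bohl_ring = \<lparr>carrier = bohl, mult = (\<lambda>f g t. f t * g t), one = (\<lambda>t. 1),
     zero = (\<lambda>t. 0), add = (\<lambda>f g t. f t + g t)\<rparr>"

text \<open>Elements of the Bohl algebra may be unbounded, so the supremum is taken in the extended
  reals, where it may be infinite.\<close>

definition unif_ball :: "(real \<Rightarrow> complex) \<Rightarrow> real \<Rightarrow> (real \<Rightarrow> complex) set" where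
  "unif_ball f e = {g \<in> bohl. (SUP t. ereal (cmod (f t - g t))) < ereal e}"

definition bohl_topology :: "(real \<Rightarrow> complex) topology" where
  "bohl_topology = topology_generated_by {unif_ball f e | f e. f \<in> bohl \<and> e > 0}"

text \<open>Tuples over the carrier are extensional functions on \<open>{1..n}\<close>.  The following two
  definitions are meant for a commutative ring \<open>R\<close> with \<open>\<one> \<noteq> \<zero>\<close> and a topology \<open>T\<close> with
  \<open>topspace T = carrier R\<close>.\<close>

definition invertible_tuples :: "('a, 'b) ring_scheme \<Rightarrow> nat \<Rightarrow> (nat \<Rightarrow> 'a) set" where
  "invertible_tuples R n = {f \<in> {1..n} \<rightarrow>\<^sub>E carrier R.
     \<exists>x \<in> {1..n} \<rightarrow>\<^sub>E carrier R. (\<Oplus>\<^bsub>R\<^esub>j\<in>{1..n}. x j \<otimes>\<^bsub>R\<^esub> f j) = \<one>\<^bsub>R\<^esub>}"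

text \<open>The infimum of the empty set in \<^typ>\<open>enat\<close> is \<open>\<infinity>\<close>.\<close>

definition topological_stable_rank :: "('a, 'b) ring_scheme \<Rightarrow> 'a topology \<Rightarrow> enat" where
  "topological_stable_rank R T = Inf {enat n | n. n \<ge> 1 \<and>
     product_topology (\<lambda>_. T) {1..n} closure_of invertible_tuples R n = ({1..n} \<rightarrow>\<^sub>E carrier R)}"

lemma bohl_monomial: "(\<lambda>t. c * complex_of_real t ^ m * exp (l * complex_of_real t)) \<in> bohl"
  unfolding bohl_def
  by (rule CollectI, rule exI[of _ 1], rule exI[of _ "\<lambda>_. c"], rule exI[of _ "\<lambda>_. m"],
      rule exI[of _ "\<lambda>_. l"]) simp

lemma bohl_const: "(\<lambda>t. c) \<in> bohl"
  using bohl_monomial[of c 0 0] by simp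

lemma bohl_add:
  assumes "f \<in> bohl" "g \<in> bohl"
  shows "(\<lambda>t. f t + g t) \<in> bohl"
proof -
  obtain N c m l where N: "N \<ge> (1::nat)"
    and f: "f = (\<lambda>t. \<Sum>n=1..N. c n * complex_of_real t ^ m n * exp (l n * complex_of_real t))"
    using assms(1) unfolding bohl_def by blast
  obtain N' c' m' l' where N': "N' \<ge> (1::nat)"
    and g: "g = (\<lambda>t. \<Sum>n=1..N'. c' n * complex_of_real t ^ m' n * exp (l' n * complex_of_real t))"
    using assms(2) unfolding bohl_def by blast
  define C where "C = (\<lambda>n. if n \<le> N then c n else c' (n - N))"
  define M where "M = (\<lambda>n. if n \<le> N then m n else m' (n - N))"
  define L where "L = (\<lambda>n. if n \<le> N then l n else l' (n - N))"
  have "f t + g t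
      = (\<Sum>n=1..N+N'. C n * complex_of_real t ^ M n * exp (L n * complex_of_real t))" for t
  proof -
    have "(\<Sum>n=1..N+N'. C n * complex_of_real t ^ M n * exp (L n * complex_of_real t))
        = (\<Sum>n=1..N. C n * complex_of_real t ^ M n * exp (L n * complex_of_real t))
        + (\<Sum>n=N+1..N+N'. C n * complex_of_real t ^ M n * exp (L n * complex_of_real t))"
      using N by (intro sum.ub_add_nat) simp
    also have "(\<Sum>n=N+1..N+N'. C n * complex_of_real t ^ M n * exp (L n * complex_of_real t))
        = (\<Sum>n=1..N'. C (n+N) * complex_of_real t ^ M (n+N) * exp (L (n+N) * complex_of_real t))"
      using sum.shift_bounds_cl_nat_ivl
        [of "\<lambda>n. C n * complex_of_real t ^ M n * exp (L n * complex_of_real t)" 1 N N']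
      by (simp add: add.commute)
    also have "\<dots> = g t"
      unfolding g C_def M_def L_def by (intro sum.cong) auto
    also have "(\<Sum>n=1..N. C n * complex_of_real t ^ M n * exp (L n * complex_of_real t)) = f t"
      unfolding f C_def M_def L_def by (intro sum.cong) auto
    finally show ?thesis by simp
  qed
  then show ?thesis
    using N unfolding bohl_def by (intro CollectI exI[of _ "N+N'"] exI[of _ C] exI[of _ M] exI[of _ L]) auto
qed

lemma bohl_sum:
  assumes "finite A" "\<And>n. n \<in> A \<Longrightarrow> F n \<in> bohl"
  shows "(\<lambda>t. \<Sum>n\<in>A. F n t) \<in> bohl"
  using assms by (induction A rule: finite_induct) (auto intro: bohl_add bohl_const)

lemma bohl_mult:
  assumes "f \<in> bohl" "g \<in> bohl"
  shows "(\<lambda>t. f t * g t) \<in> bohl"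
proof -
  obtain N c m l where
    f: "f = (\<lambda>t. \<Sum>n=1..(N::nat). c n * complex_of_real t ^ m n * exp (l n * complex_of_real t))"
    using assms(1) unfolding bohl_def by blast
  obtain N' c' m' l' where
    g: "g = (\<lambda>t. \<Sum>n=1..(N'::nat). c' n * complex_of_real t ^ m' n * exp (l' n * complex_of_real t))"
    using assms(2) unfolding bohl_def by blast
  have "(\<lambda>t. f t * g t) = (\<lambda>t. \<Sum>n=1..N. \<Sum>k=1..N'. (c n * c' k) * complex_of_real t ^ (m n + m' k)
      * exp ((l n + l' k) * complex_of_real t))"
    unfolding f g sum_product
    by (intro ext sum.cong refl) (simp only: power_add exp_add distrib_left distrib_right mult_ac)
  also have "\<dots> \<in> bohl"
    by (intro bohl_sum bohl_monomial finite_atLeastAtMost)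
  finally show ?thesis .
qed

lemma cring_bohl_ring: "cring bohl_ring"
proof (rule cringI)
  show "abelian_group bohl_ring"
  proof (rule abelian_groupI)
    fix f assume "f \<in> carrier bohl_ring"
    then have "(\<lambda>t. (- 1) * f t) \<in> bohl"
      using bohl_mult[OF bohl_const, of f "- 1"] by (simp only: bohl_ring_def partial_object.simps)
    then show "\<exists>g\<in>carrier bohl_ring. g \<oplus>\<^bsub>bohl_ring\<^esub> f = \<zero>\<^bsub>bohl_ring\<^esub>"
      by (intro bexI[of _ "\<lambda>t. (- 1) * f t"]) (auto simp: bohl_ring_def)
  qed (auto simp: bohl_ring_def bohl_const bohl_add algebra_simps)
  show "Group.comm_monoid bohl_ring"
    by (rule Group.comm_monoidI) (auto simp: bohl_ring_def bohl_const bohl_mult algebra_simps)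
qed (auto simp: bohl_ring_def algebra_simps)

lemma bohl_ring_one_neq_zero: "\<one>\<^bsub>bohl_ring\<^esub> \<noteq> \<zero>\<^bsub>bohl_ring\<^esub>"
  by (auto simp: bohl_ring_def fun_eq_iff)

lemma unif_ball_centre: "f \<in> bohl \<Longrightarrow> e > 0 \<Longrightarrow> f \<in> unif_ball f e"
  by (simp add: unif_ball_def)

lemma topspace_bohl_topology: "topspace bohl_topology = carrier bohl_ring"
proof
  show "topspace bohl_topology \<subseteq> carrier bohl_ring"
    unfolding bohl_topology_def topology_generated_by_topspace
    by (auto simp: unif_ball_def bohl_ring_def)
  have "f \<in> topspace bohl_topology" if "f \<in> bohl" for f
    unfolding bohl_topology_def topology_generated_by_topspace
    using that unif_ball_centre[OF that zero_less_one] zero_less_one by blast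
  then show "carrier bohl_ring \<subseteq> topspace bohl_topology"
    by (auto simp: bohl_ring_def)
qed

lemma unif_ball_refine:
  assumes "g \<in> unif_ball f e"
  shows "\<exists>d>0. unif_ball g d \<subseteq> unif_ball f e"
proof -
  define s where "s = (SUP t. ereal (cmod (f t - g t)))"
  have "ereal (cmod (f 0 - g 0)) \<le> s" unfolding s_def by (rule SUP_upper) simp
  then have s0: "0 \<le> s" by (meson ereal_less_eq(5) norm_ge_zero order_trans)
  have se: "s < ereal e" using assms by (simp add: unif_ball_def s_def)
  obtain r where r: "s = ereal r" using s0 se by (cases s) auto
  have "unif_ball g ((e - r) / 2) \<subseteq> unif_ball f e"
  proof
    fix h assume h: "h \<in> unif_ball g ((e - r) / 2)"
    have "cmod (f t - h t) \<le> r + (e - r) / 2" for t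
    proof -
      have "ereal (cmod (f t - g t)) \<le> s" unfolding s_def by (rule SUP_upper) simp
      moreover have "ereal (cmod (g t - h t)) \<le> (SUP t. ereal (cmod (g t - h t)))"
        by (rule SUP_upper) simp
      then have "ereal (cmod (g t - h t)) < ereal ((e - r) / 2)"
        using h unfolding unif_ball_def mem_Collect_eq by (meson order.strict_trans1)
      ultimately show ?thesis
        using r norm_triangle_ineq[of "f t - g t" "g t - h t"] by (simp add: field_simps)
    qed
    then have "(SUP t. ereal (cmod (f t - h t))) \<le> ereal (r + (e - r) / 2)"
      by (intro SUP_least) simp
    also have "\<dots> < ereal e" using se r by (simp add: field_simps)
    finally show "h \<in> unif_ball f e" using h by (simp add: unif_ball_def)
  qed
  then show ?thesis using se r by (intro exI[of _ "(e - r) / 2"]) auto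
qed

text \<open>The balls, introduced above as a subbasis, are a basis.\<close>

lemma openin_bohl_topology_iff:
  "openin bohl_topology U \<longleftrightarrow> U \<subseteq> bohl \<and> (\<forall>f\<in>U. \<exists>e>0. unif_ball f e \<subseteq> U)"
proof
  assume U: "openin bohl_topology U"
  have "generate_topology_on {unif_ball f e | f e. f \<in> bohl \<and> e > 0} U"
    using U by (simp add: bohl_topology_def openin_topology_generated_by_iff)
  then have "\<forall>f\<in>U. \<exists>e>0. unif_ball f e \<subseteq> U"
  proof induction
    case (Int a b)
    show ?case
    proof
      fix f assume "f \<in> a \<inter> b"
      then obtain d e where de: "d > 0" "unif_ball f d \<subseteq> a" "e > 0" "unif_ball f e \<subseteq> b"
        using Int by blast
      have "unif_ball f (min d e) \<subseteq> unif_ball f d \<inter> unif_ball f e"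
        by (auto simp: unif_ball_def min_def split: if_splits)
          (metis ereal_less_eq(3) less_le_trans linorder_le_cases)+
      then show "\<exists>e>0. unif_ball f e \<subseteq> a \<inter> b"
        using de by (intro exI[of _ "min d e"]) auto
    qed
  next
    case (UN K)
    then show ?case by (meson Union_iff Union_upper order_trans)
  next
    case (Basis s)
    then show ?case using unif_ball_refine by blast
  qed simp
  then show "U \<subseteq> bohl \<and> (\<forall>f\<in>U. \<exists>e>0. unif_ball f e \<subseteq> U)"
    using openin_subset[OF U] topspace_bohl_topology by (simp add: bohl_ring_def)
next
  assume U: "U \<subseteq> bohl \<and> (\<forall>f\<in>U. \<exists>e>0. unif_ball f e \<subseteq> U)"
  have "\<exists>V. openin bohl_topology V \<and> f \<in> V \<and> V \<subseteq> U" if f: "f \<in> U" for f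
  proof -
    obtain e where "e > 0" "unif_ball f e \<subseteq> U" using U f by blast
    moreover have "openin bohl_topology (unif_ball f e)"
      using U f \<open>e > 0\<close> unfolding bohl_topology_def by (intro topology_generated_by_Basis) auto
    ultimately show ?thesis using unif_ball_centre U f by blast
  qed
  then show "openin bohl_topology U" by (subst openin_subopen) auto
qed

end

theory Submission
  imports Defs "HOL-Library.Poly_Mapping" "HOL-Computational_Algebra.Fundamental_Theorem_Algebra"
    "HOL-Real_Asymp.Real_Asymp"
begin

text \<open>For every \<open>n\<close> there is an \<open>n\<close>-tuple none of whose perturbations by less than \<open>1 / 2\<close> is
  invertible, namely \<open>sin (a\<^sub>j * t) + \<i> * sin (b\<^sub>j * t)\<close> for \<open>1 \<le> j \<le> n\<close>, where the \<open>2 * n\<close>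
  frequencies are linearly independent over \<open>\<rat>\<close>. If their phases could be varied independently, the
  tuple would be the map \<open>(\<theta>, \<psi>) \<mapsto> (sin \<theta>\<^sub>j + \<i> * sin \<psi>\<^sub>j)\<^sub>j\<close>, which takes a cube around the
  origin homeomorphically onto a cube in \<open>\<complex>\<^sup>n\<close>. The zero of such a map survives every small continuous
  perturbation, by Brouwer's theorem, while an invertible tuple has no common zero.

  Independent phases are provided by characters. The Bohl algebra is the group algebra of
  \<open>(\<complex>, +)\<close> over \<open>\<complex>[t]\<close> (\<open>bohl_fun_eq_0D\<close> gives the linear independence that this needs), so each
  homomorphism \<open>\<phi>\<close> from \<open>(\<complex>, +)\<close> to the unit group of \<open>\<complex>\<close> defines a ring homomorphism to
  \<open>\<complex>\<close>, by \<open>t \<mapsto> 0\<close> and \<open>exp (\<kappa> * t) \<mapsto> \<phi> \<kappa>\<close>. It preserves Bezout identities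
  (\<open>bezout_bounds_characters\<close>). Rational coordinates on \<open>\<real>\<close> give characters \<open>\<phi>\<close> of modulus one with
  prescribed phases at the chosen frequencies, depending continuously on these phases.

  It remains to see that a perturbation \<open>h\<close> that is uniformly small has a small image. A bounded
  element of the Bohl algebra is a trigonometric polynomial (\<open>bounded_bohl_fun_keys\<close>), its coefficients
  are bounded by its supremum, and comparison of the powers of \<open>h\<close> then shows that its image is
  bounded by the supremum as well (\<open>char_eval_le_sup\<close>).

  Since the length of the tuple is arbitrary, Brouwer's theorem is used in the form of the
  combinatorial lemma behind it (\<open>poincare_miranda_approx\<close>), in a dimension that is a natural number.
  It yields only approximate zeros; these suffice, because a Bezout identity bounds the values
  of the tuple from below, uniformly over all characters of modulus one.\<close>

section \<open>The Bohl algebra as a group algebra\<close>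

text \<open>The group algebra of \<open>(\<complex>, +)\<close> over \<open>\<complex>[t]\<close>: the key \<open>\<kappa>\<close> stands for the
  exponential \<open>exp (\<kappa> * t)\<close>, and multiplication is convolution. Working here makes it possible
  to replace the exponentials by the values of an arbitrary character.\<close>

type_synonym exp_poly = "complex \<Rightarrow>\<^sub>0 complex poly"

definition char_eval :: "complex \<Rightarrow> (complex \<Rightarrow> complex) \<Rightarrow> exp_poly \<Rightarrow> complex" where
  "char_eval z \<phi> P = (\<Sum>\<kappa>\<in>Poly_Mapping.keys P. poly (Poly_Mapping.lookup P \<kappa>) z * \<phi> \<kappa>)"

text \<open>A homomorphism from \<open>(\<complex>, +)\<close> to the unit group of \<open>\<complex>\<close>: \<open>\<phi> \<kappa>\<close> and \<open>\<phi> (- \<kappa>)\<close> are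
  inverse to each other.\<close>

definition character :: "(complex \<Rightarrow> complex) \<Rightarrow> bool" where
  "character \<phi> \<longleftrightarrow> \<phi> 0 = 1 \<and> (\<forall>\<kappa> \<mu>. \<phi> (\<kappa> + \<mu>) = \<phi> \<kappa> * \<phi> \<mu>)"

abbreviation exp_char :: "real \<Rightarrow> complex \<Rightarrow> complex" where
  "exp_char t \<equiv> \<lambda>\<kappa>. exp (\<kappa> * of_real t)"

definition bohl_fun :: "exp_poly \<Rightarrow> real \<Rightarrow> complex" where
  "bohl_fun P t = char_eval (of_real t) (exp_char t) P"

lemma character_exp: "character (exp_char t)"
  by (simp add: character_def distrib_right exp_add)

lemma char_eval_superset:
  assumes "finite L" "Poly_Mapping.keys P \<subseteq> L"
  shows "char_eval z \<phi> P = (\<Sum>\<kappa>\<in>L. poly (Poly_Mapping.lookup P \<kappa>) z * \<phi> \<kappa>)"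
  unfolding char_eval_def using assms
  by (intro sum.mono_neutral_left) (auto simp: in_keys_iff)

lemma char_eval_0 [simp]: "char_eval z \<phi> 0 = 0"
  by (simp add: char_eval_def)

lemma char_eval_single [simp]: "char_eval z \<phi> (Poly_Mapping.single \<kappa> p) = poly p z * \<phi> \<kappa>"
  by (simp add: char_eval_def)

lemma char_eval_add: "char_eval z \<phi> (P + Q) = char_eval z \<phi> P + char_eval z \<phi> Q"
proof -
  let ?L = "Poly_Mapping.keys P \<union> Poly_Mapping.keys Q"
  show ?thesis
    using keys_add[of P Q]
    by (simp add: char_eval_superset[of ?L] lookup_add sum.distrib[symmetric] distrib_right)
qed

lemma char_eval_uminus: "char_eval z \<phi> (- P) = - char_eval z \<phi> P"
  using char_eval_add[of z \<phi> P "- P"] by (simp add: eq_neg_iff_add_eq_0 add.commute)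

lemma char_eval_diff: "char_eval z \<phi> (P - Q) = char_eval z \<phi> P - char_eval z \<phi> Q"
  using char_eval_add[of z \<phi> P "- Q"] by (simp add: char_eval_uminus)

lemma char_eval_sum: "char_eval z \<phi> (\<Sum>i\<in>I. P i) = (\<Sum>i\<in>I. char_eval z \<phi> (P i))"
  by (induction I rule: infinite_finite_induct) (simp_all add: char_eval_add)

lemma exp_poly_monomials: "(\<Sum>\<kappa>\<in>Poly_Mapping.keys P. Poly_Mapping.single \<kappa> (Poly_Mapping.lookup P \<kappa>)) = P"
  for P :: exp_poly
proof (rule poly_mapping_eqI)
  fix k
  have "Poly_Mapping.lookup (\<Sum>\<kappa>\<in>Poly_Mapping.keys P. Poly_Mapping.single \<kappa> (Poly_Mapping.lookup P \<kappa>)) k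
      = (\<Sum>\<kappa>\<in>Poly_Mapping.keys P. if \<kappa> = k then Poly_Mapping.lookup P \<kappa> else 0)"
    by (simp add: lookup_sum lookup_single when_def)
  also have "\<dots> = Poly_Mapping.lookup P k"
    by (simp add: sum.delta' in_keys_iff)
  finally show "Poly_Mapping.lookup (\<Sum>\<kappa>\<in>Poly_Mapping.keys P. Poly_Mapping.single \<kappa> (Poly_Mapping.lookup P \<kappa>)) k = Poly_Mapping.lookup P k" .
qed

lemma char_eval_mult:
  assumes "character \<phi>"
  shows "char_eval z \<phi> (P * Q) = char_eval z \<phi> P * char_eval z \<phi> Q"
proof -
  have "P * Q = (\<Sum>\<kappa>\<in>Poly_Mapping.keys P. \<Sum>\<mu>\<in>Poly_Mapping.keys Q.
      Poly_Mapping.single (\<kappa> + \<mu>) (Poly_Mapping.lookup P \<kappa> * Poly_Mapping.lookup Q \<mu>))"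
    using arg_cong2[OF exp_poly_monomials[of P] exp_poly_monomials[of Q], of "(*)"]
    by (simp add: sum_product mult_single)
  then have "char_eval z \<phi> (P * Q) = (\<Sum>\<kappa>\<in>Poly_Mapping.keys P. \<Sum>\<mu>\<in>Poly_Mapping.keys Q.
      poly (Poly_Mapping.lookup P \<kappa>) z * \<phi> \<kappa> * (poly (Poly_Mapping.lookup Q \<mu>) z * \<phi> \<mu>))"
    using assms by (simp add: char_eval_sum character_def mult_ac)
  then show ?thesis by (simp add: sum_product char_eval_def)
qed

lemma char_eval_one: "character \<phi> \<Longrightarrow> char_eval z \<phi> 1 = 1"
  by (simp add: char_eval_def character_def)

lemma char_eval_power:
  "character \<phi> \<Longrightarrow> char_eval z \<phi> (P ^ k) = char_eval z \<phi> P ^ k"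
  by (induction k) (simp_all add: char_eval_one char_eval_mult)

lemma bohl_obtain_exp_poly:
  assumes "f \<in> bohl"
  obtains P where "bohl_fun P = f"
proof -
  obtain N c m l where f: "f = (\<lambda>t. \<Sum>n=1..(N::nat). c n * complex_of_real t ^ m n * exp (l n * complex_of_real t))"
    using assms unfolding bohl_def by blast
  have "bohl_fun (\<Sum>n=1..N. Poly_Mapping.single (l n) (monom (c n) (m n))) = f"
    by (simp add: fun_eq_iff f bohl_fun_def char_eval_sum poly_monom)
  then show thesis by (rule that)
qed

text \<open>The frequencies of \<open>P ^ k\<close> are sums of \<open>k\<close> frequencies of \<open>P\<close>, and such a sum
  is determined by how often each frequency occurs in it. That the bound is polynomial in \<open>k\<close> is used in
  \<open>char_eval_le_sup\<close>.\<close>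

lemma card_keys_power:
  "card (Poly_Mapping.keys (P ^ k)) \<le> (k + 1) ^ card (Poly_Mapping.keys P)" for P :: exp_poly
proof -
  let ?L = "Poly_Mapping.keys P"
  let ?S = "\<lambda>k. (\<lambda>u. \<Sum>\<kappa>\<in>?L. of_nat (u \<kappa>) * \<kappa>) ` (?L \<rightarrow>\<^sub>E {..k})"
  have "Poly_Mapping.keys (P ^ k) \<subseteq> ?S k"
  proof (induction k)
    case 0
    show ?case by (auto simp: image_iff intro!: bexI[of _ "\<lambda>\<kappa>\<in>?L. 0"])
  next
    case (Suc k)
    show ?case
    proof
      fix x assume "x \<in> Poly_Mapping.keys (P ^ Suc k)"
      then obtain a b where a: "a \<in> ?L" and b: "b \<in> Poly_Mapping.keys (P ^ k)" and x: "x = a + b"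
        using keys_mult[of P "P ^ k"] by auto
      obtain u where u: "u \<in> ?L \<rightarrow>\<^sub>E {..k}" "b = (\<Sum>\<kappa>\<in>?L. of_nat (u \<kappa>) * \<kappa>)"
        using Suc b by auto
      have "x = (\<Sum>\<kappa>\<in>?L. of_nat ((u(a := Suc (u a))) \<kappa>) * \<kappa>)"
        using a by (simp add: x u(2) sum.remove[of ?L a] algebra_simps)
      moreover have "u(a := Suc (u a)) \<in> ?L \<rightarrow>\<^sub>E {..Suc k}"
        using u(1) a by (fastforce simp: PiE_iff extensional_def)
      ultimately show "x \<in> ?S (Suc k)" by blast
    qed
  qed
  then have "card (Poly_Mapping.keys (P ^ k)) \<le> card (?S k)"
    by (intro card_mono finite_imageI finite_PiE) auto
  also have "\<dots> \<le> card (?L \<rightarrow>\<^sub>E {..k})"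
    by (intro card_image_le finite_PiE) auto
  also have "\<dots> = (k + 1) ^ card ?L"
    by (simp add: card_PiE)
  finally show ?thesis .
qed

lemma bohl_fun_in_bohl: "bohl_fun P \<in> bohl"
proof -
  have "bohl_fun P = (\<lambda>t. \<Sum>\<kappa>\<in>Poly_Mapping.keys P. \<Sum>i\<le>degree (Poly_Mapping.lookup P \<kappa>).
      coeff (Poly_Mapping.lookup P \<kappa>) i * of_real t ^ i * exp (\<kappa> * of_real t))"
    by (simp add: fun_eq_iff bohl_fun_def char_eval_def poly_altdef sum_distrib_right)
  also have "\<dots> \<in> bohl"
    by (intro bohl_sum bohl_monomial) auto
  finally show ?thesis .
qed

section \<open>Bounded exponential polynomials\<close>

lemma exp_neq_1_if_small:
  fixes w :: complex
  assumes "w \<noteq> 0" "cmod w \<le> 1"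
  shows "exp w \<noteq> 1"
proof
  assume "exp w = 1"
  then obtain n :: int where n: "Re w = 0" "Im w = of_int (2 * n) * pi"
    unfolding exp_eq_1 by blast
  have "2 * \<bar>real_of_int n\<bar> * pi \<le> 1"
    using n assms(2) by (simp add: cmod_eq_Im abs_mult)
  moreover have "n = 0 \<or> \<bar>real_of_int n\<bar> \<ge> 1" by linarith
  ultimately have "n = 0" using pi_gt3 mult_mono[of 1 "\<bar>real_of_int n\<bar>" 3 pi] by auto
  then show False using n assms(1) by (simp add: complex_eq_iff)
qed

text \<open>Boundedness is inherited by the translate \<open>h(t + s)\<close>, hence by
  \<open>h(t + s) - exp (\<mu> * s) * h(t)\<close>. This operation lowers the degree of the polynomial in front of
  \<open>exp (\<mu> * t)\<close>, and for a suitable \<open>s\<close> keeps the degree of the one in front of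
  \<open>exp (\<kappa> * t)\<close>. Iterating it removes all frequencies other than \<open>\<kappa>\<close>.\<close>

lemma isolated_component:
  fixes p :: "complex poly" and q :: "complex \<Rightarrow> complex poly"
  assumes "finite L" "\<kappa> \<notin> L"
    and "bounded (range (\<lambda>t. poly p (of_real t) * exp (\<kappa> * of_real t)
           + (\<Sum>\<mu>\<in>L. poly (q \<mu>) (of_real t) * exp (\<mu> * of_real t))))"
  shows "\<exists>r. degree r = degree p \<and> (p \<noteq> 0 \<longrightarrow> r \<noteq> 0) \<and>
           bounded (range (\<lambda>t. poly r (of_real t) * exp (\<kappa> * of_real t)))"
  using assms
proof (induction L arbitrary: p q rule: finite_induct)
  case empty
  then show ?case by auto
next
  case (insert \<mu> L)
  show ?case
    using insert.prems
  proof (induction "if q \<mu> = 0 then 0 else Suc (degree (q \<mu>))" arbitrary: p q rule: less_induct)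
    case less
    let ?h = "\<lambda>t. poly p (of_real t) * exp (\<kappa> * of_real t)
           + (\<Sum>\<nu>\<in>insert \<mu> L. poly (q \<nu>) (of_real t) * exp (\<nu> * of_real t))"
    show ?case
    proof (cases "q \<mu> = 0")
      case True
      then show ?thesis using insert.IH[of p q] insert.hyps less.prems by auto
    next
      case False
      define s :: real where "s = 1 / cmod (\<kappa> - \<mu>)"
      have "\<kappa> \<noteq> \<mu>" using less.prems by auto
      have "exp ((\<kappa> - \<mu>) * of_real s) \<noteq> 1"
        using \<open>\<kappa> \<noteq> \<mu>\<close> by (intro exp_neq_1_if_small) (auto simp: s_def norm_mult norm_divide)
      then have s: "exp (\<kappa> * of_real s) \<noteq> exp (\<mu> * of_real s)"
        by (auto simp: left_diff_distrib exp_diff)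
      \<comment> \<open>The operator sending \<open>h\<close> to \<open>h(t + s) - exp (\<mu> * s) * h(t)\<close>, on polynomial factors.\<close>
      define T where "T \<nu> w = smult (exp (\<nu> * of_real s)) (w \<circ>\<^sub>p [:of_real s, 1:]) - smult (exp (\<mu> * of_real s)) w"
        for \<nu> :: complex and w :: "complex poly"
      have T_poly: "poly (T \<nu> w) (of_real t) * exp (\<nu> * of_real t)
          = poly w (of_real (t + s)) * exp (\<nu> * of_real (t + s)) - exp (\<mu> * of_real s) * (poly w (of_real t) * exp (\<nu> * t))"
        for \<nu> w t
        by (simp add: T_def poly_pcompose algebra_simps exp_add)
      have "bounded (range (\<lambda>t. ?h (t + s) - exp (\<mu> * of_real s) * ?h t))"
      proof -
        from less.prems obtain C where C: "cmod (?h t) \<le> C" for t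
          unfolding bounded_iff by blast
        have "cmod (?h (t + s) - exp (\<mu> * of_real s) * ?h t) \<le> C + cmod (exp (\<mu> * of_real s)) * C" for t
          by (rule order_trans[OF norm_triangle_ineq4]) (simp only: norm_mult add_mono C mult_left_mono norm_ge_zero)
        then show ?thesis unfolding bounded_iff by blast
      qed
      also have "(\<lambda>t. ?h (t + s) - exp (\<mu> * of_real s) * ?h t) = (\<lambda>t. poly (T \<kappa> p) (of_real t) * exp (\<kappa> * of_real t)
           + (\<Sum>\<nu>\<in>insert \<mu> L. poly (T \<nu> (q \<nu>)) (of_real t) * exp (\<nu> * of_real t)))"
        unfolding T_poly sum_subtractf sum_distrib_left[symmetric] by (simp only: ring_distribs) (simp add: algebra_simps)
      finally have bdd: "bounded (range (\<lambda>t. poly (T \<kappa> p) (of_real t) * exp (\<kappa> * of_real t)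
           + (\<Sum>\<nu>\<in>insert \<mu> L. poly (T \<nu> (q \<nu>)) (of_real t) * exp (\<nu> * of_real t))))" .
      have lc: "coeff (w \<circ>\<^sub>p [:of_real s, 1:]) (degree w) = lead_coeff w"
        and deg: "degree (w \<circ>\<^sub>p [:of_real s, 1:]) = degree w" for w :: "complex poly"
        using lead_coeff_comp[of "[:of_real s, 1:]" w] degree_pcompose[of w "[:of_real s, 1:]"] by auto
      have T_deg_le: "degree (T \<nu> w) \<le> degree w" for \<nu> w
        unfolding T_def by (intro degree_diff_le order_trans[OF degree_smult_le]) (auto simp: deg)
      have "coeff (T \<mu> (q \<mu>)) (degree (q \<mu>)) = 0"
        by (simp add: T_def lc)
      then have "T \<mu> (q \<mu>) = 0 \<or> degree (T \<mu> (q \<mu>)) < degree (q \<mu>)"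
        using T_deg_le[of \<mu> "q \<mu>"] by (metis le_neq_implies_less leading_coeff_0_iff)
      then have smaller: "(if T \<mu> (q \<mu>) = 0 then 0 else Suc (degree (T \<mu> (q \<mu>)))) < (if q \<mu> = 0 then 0 else Suc (degree (q \<mu>)))"
        using False by auto
      obtain r where r: "degree r = degree (T \<kappa> p)" "T \<kappa> p \<noteq> 0 \<longrightarrow> r \<noteq> 0"
        "bounded (range (\<lambda>t. poly r (of_real t) * exp (\<kappa> * of_real t)))"
        using less.hyps[of "\<lambda>\<nu>. T \<nu> (q \<nu>)" "T \<kappa> p", OF smaller less.prems(1) bdd] by blast
      have "coeff (T \<kappa> p) (degree p) = (exp (\<kappa> * of_real s) - exp (\<mu> * of_real s)) * lead_coeff p"
        by (simp add: T_def lc algebra_simps)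
      then have "p \<noteq> 0 \<longrightarrow> coeff (T \<kappa> p) (degree p) \<noteq> 0" using s by simp
      moreover then have "degree (T \<kappa> p) = degree p"
        using T_deg_le[of \<kappa> p] by (metis T_deg_le degree_0 le_antisym le_degree le_zero_eq)
      ultimately show ?thesis using r by auto
    qed
  qed
qed

text \<open>If \<open>p\<close> is not constant or \<open>Re \<kappa> \<noteq> 0\<close>, then the function is unbounded along the half-line
  on which \<open>exp (Re \<kappa> * t) \<ge> 1\<close>; \<open>\<sigma>\<close> is the direction of that half-line.\<close>

lemma bounded_exponential_monomial:
  assumes "bounded (range (\<lambda>t. poly p (of_real t) * exp (\<kappa> * of_real t)))" and "p \<noteq> 0"
  shows "degree p = 0 \<and> Re \<kappa> = 0"
proof -
  obtain M where M: "cmod (poly p (of_real t)) * exp (Re \<kappa> * t) \<le> M" for t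
    using assms(1) by (auto simp: bounded_iff norm_mult)
  have M0: "M \<ge> 0" using M[of 0] by (smt (verit) norm_ge_zero exp_ge_zero mult_nonneg_nonneg)
  obtain \<sigma> :: real where \<sigma>: "\<bar>\<sigma>\<bar> = 1" "Re \<kappa> * \<sigma> = \<bar>Re \<kappa>\<bar>"
    using that[of "if Re \<kappa> \<ge> 0 then 1 else -1"] by auto
  have "degree p = 0"
  proof (rule ccontr)
    assume d: "degree p \<noteq> 0"
    obtain a p' where p': "p = pCons a p'" "p' \<noteq> 0" using d by (cases p) (auto split: if_splits)
    obtain r where r: "\<And>z. r \<le> cmod z \<Longrightarrow> M + 1 \<le> cmod (poly p z)"
      using poly_infinity[OF p'(2), of "M + 1" a] p' by blast
    define t where "t = \<sigma> * \<bar>r\<bar>"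
    have "M + 1 \<le> cmod (poly p (of_real t))" by (rule r) (simp add: t_def abs_mult \<sigma> del: of_real_mult)
    moreover have "1 \<le> exp (Re \<kappa> * t)" using \<sigma> by (simp add: t_def mult.assoc[symmetric])
    ultimately have "M + 1 \<le> cmod (poly p (of_real t)) * exp (Re \<kappa> * t)"
      using M0 by (smt (verit) mult_le_cancel_left1)
    then show False using M[of t] by simp
  qed
  then obtain c where c: "p = [:c:]" by (metis degree_eq_zeroE)
  have "Re \<kappa> = 0"
  proof (rule ccontr)
    assume nz: "Re \<kappa> \<noteq> 0"
    have c0: "c \<noteq> 0" using c assms(2) by simp
    define t where "t = \<sigma> * (M / cmod c / \<bar>Re \<kappa>\<bar>)"
    have "Re \<kappa> * t = M / cmod c" using nz \<sigma> by (simp add: t_def mult.assoc[symmetric])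
    then have "1 + M / cmod c \<le> exp (Re \<kappa> * t)" by (metis exp_ge_add_one_self)
    then have "cmod c * (1 + M / cmod c) \<le> M" using M[of t] c
      by (smt (verit) mult_left_mono norm_ge_zero poly_const_conv)
    then show False using c0 by (simp add: distrib_left)
  qed
  with \<open>degree p = 0\<close> show ?thesis by simp
qed

text \<open>A Fourier coefficient is a mean value. The mean is taken over the progression \<open>0, s, 2 * s, ...\<close>,
  with \<open>s\<close> so small that different frequencies are still distinguished on it; the contributions of
  the other frequencies are then bounded geometric sums, divided by the number of terms.\<close>

lemma trig_coefficient_le:
  fixes c :: "complex \<Rightarrow> complex"
  assumes "finite L" "\<kappa> \<in> L" and imag: "\<And>\<mu>. \<mu> \<in> L \<Longrightarrow> Re \<mu> = 0"
    and bound: "\<And>t. cmod (\<Sum>\<mu>\<in>L. c \<mu> * exp (\<mu> * of_real t)) \<le> M"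
  shows "cmod (c \<kappa>) \<le> M"
proof -
  let ?D = "\<Sum>\<mu>\<in>L. cmod (\<mu> - \<kappa>)"
  define s where "s = 1 / (1 + ?D)"
  have D: "?D \<ge> 0" by (simp add: sum_nonneg)
  define z where "z \<mu> = exp ((\<mu> - \<kappa>) * of_real s)" for \<mu>
  have z1: "z \<mu> \<noteq> 1" if \<mu>: "\<mu> \<in> L - {\<kappa>}" for \<mu>
  proof -
    have "cmod (\<mu> - \<kappa>) \<le> ?D" using \<mu> assms by (intro member_le_sum) auto
    then have "cmod ((\<mu> - \<kappa>) * of_real s) \<le> 1" using D
      by (simp add: s_def norm_mult norm_divide divide_simps del: of_real_add of_real_sum)
    moreover have "s \<noteq> 0" using D by (simp add: s_def)
    ultimately show ?thesis using \<mu> unfolding z_def by (intro exp_neq_1_if_small) auto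
  qed
  have zn: "cmod (z \<mu>) = 1" if "\<mu> \<in> L" for \<mu>
    using imag[OF that] imag[OF \<open>\<kappa> \<in> L\<close>] by (simp add: z_def)
  define K where "K = (\<Sum>\<mu>\<in>L - {\<kappa>}. cmod (c \<mu>) * (2 / cmod (z \<mu> - 1)))"
  have avg: "cmod (c \<kappa>) \<le> M + K / real N" if "N > 0" for N
  proof -
    let ?h = "\<lambda>n. (\<Sum>\<mu>\<in>L. c \<mu> * exp (\<mu> * of_real (real n * s))) * exp (- \<kappa> * of_real (real n * s))"
    have "?h n = (\<Sum>\<mu>\<in>L. c \<mu> * z \<mu> ^ n)" for n
      unfolding sum_distrib_right
      by (intro sum.cong refl) (simp add: z_def exp_of_nat_mult[symmetric] exp_add[symmetric] algebra_simps)
    then have "(\<Sum>n<N. ?h n) = (\<Sum>\<mu>\<in>L. c \<mu> * (\<Sum>n<N. z \<mu> ^ n))"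
      by (simp add: sum.swap[of _ "{..<N}"] sum_distrib_left)
    also have "\<dots> = c \<kappa> * of_nat N + (\<Sum>\<mu>\<in>L - {\<kappa>}. c \<mu> * (\<Sum>n<N. z \<mu> ^ n))"
      using assms by (simp add: sum.remove[of L \<kappa>] z_def)
    finally have eq: "c \<kappa> * of_nat N = (\<Sum>n<N. ?h n) - (\<Sum>\<mu>\<in>L - {\<kappa>}. c \<mu> * (\<Sum>n<N. z \<mu> ^ n))"
      by simp
    have "cmod (\<Sum>n<N. ?h n) \<le> N * M"
    proof -
      have "cmod (exp (- \<kappa> * of_real (real n * s))) = 1" for n
        using imag[OF \<open>\<kappa> \<in> L\<close>] by simp
      then have "cmod (?h n) \<le> M" for n
        using bound[of "real n * s"] by (simp only: norm_mult mult_1_right)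
      then show ?thesis
        using sum_norm_bound[of "{..<N}" ?h M] by (simp only: card_lessThan)
    qed
    moreover have "cmod (\<Sum>\<mu>\<in>L - {\<kappa>}. c \<mu> * (\<Sum>n<N. z \<mu> ^ n)) \<le> K"
      unfolding K_def
    proof (rule sum_norm_le)
      fix \<mu> assume \<mu>: "\<mu> \<in> L - {\<kappa>}"
      have "cmod (\<Sum>n<N. z \<mu> ^ n) = cmod (z \<mu> ^ N - 1) / cmod (z \<mu> - 1)"
        using z1[OF \<mu>] by (simp add: geometric_sum norm_divide)
      also have "\<dots> \<le> 2 / cmod (z \<mu> - 1)"
        using norm_triangle_ineq4[of "z \<mu> ^ N" 1] zn \<mu> by (intro divide_right_mono) (auto simp: norm_power)
      finally show "cmod (c \<mu> * (\<Sum>n<N. z \<mu> ^ n)) \<le> cmod (c \<mu>) * (2 / cmod (z \<mu> - 1))"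
        unfolding norm_mult by (rule mult_left_mono) simp
    qed
    ultimately have "cmod (c \<kappa> * of_nat N) \<le> N * M + K"
      unfolding eq by (meson norm_triangle_ineq4 add_mono order_trans)
    then show ?thesis using that by (simp add: norm_mult field_simps)
  qed
  have "(\<lambda>N. M + K / real N) \<longlonglongrightarrow> M + 0"
    by (intro tendsto_intros lim_const_over_n)
  then show ?thesis
    using avg by (intro LIMSEQ_le_const[of "\<lambda>N. M + K / real N"]) (auto intro!: exI[of _ 1])
qed

text \<open>Each frequency can be isolated without losing boundedness, and what remains of it is then a constant
  multiple of an oscillation. So a bounded element of the Bohl algebra is a trigonometric polynomial.\<close>

lemma bounded_bohl_fun_keys:
  assumes "\<And>t. cmod (bohl_fun P t) \<le> M" and "\<kappa> \<in> Poly_Mapping.keys P"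
  shows "degree (Poly_Mapping.lookup P \<kappa>) = 0 \<and> Re \<kappa> = 0"
proof -
  have "bohl_fun P = (\<lambda>t. poly (Poly_Mapping.lookup P \<kappa>) (of_real t) * exp (\<kappa> * of_real t)
      + (\<Sum>\<mu>\<in>Poly_Mapping.keys P - {\<kappa>}. poly (Poly_Mapping.lookup P \<mu>) (of_real t) * exp (\<mu> * of_real t)))"
    using assms(2) by (simp add: fun_eq_iff bohl_fun_def char_eval_def sum.remove)
  moreover have "bounded (range (bohl_fun P))"
    using assms(1) by (auto simp: bounded_iff)
  ultimately obtain r where "degree r = degree (Poly_Mapping.lookup P \<kappa>)" "r \<noteq> 0"
    "bounded (range (\<lambda>t. poly r (of_real t) * exp (\<kappa> * of_real t)))"
    using isolated_component[of "Poly_Mapping.keys P - {\<kappa>}" \<kappa> "Poly_Mapping.lookup P \<kappa>" "Poly_Mapping.lookup P"]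
      assms(2) by (auto simp: in_keys_iff)
  then show ?thesis using bounded_exponential_monomial[of r \<kappa>] by simp
qed

lemma bounded_bohl_fun_coefficient_le:
  assumes bound: "\<And>t. cmod (bohl_fun P t) \<le> M"
  shows "cmod (poly (Poly_Mapping.lookup P \<kappa>) 0) \<le> M"
proof (cases "\<kappa> \<in> Poly_Mapping.keys P")
  case True
  have const: "poly (Poly_Mapping.lookup P \<mu>) z = poly (Poly_Mapping.lookup P \<mu>) 0"
    if "\<mu> \<in> Poly_Mapping.keys P" for \<mu> z
    using bounded_bohl_fun_keys[OF bound that] by (metis degree_eq_zeroE poly_const_conv)
  have "bohl_fun P t = (\<Sum>\<mu>\<in>Poly_Mapping.keys P. poly (Poly_Mapping.lookup P \<mu>) 0 * exp (\<mu> * of_real t))" for t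
    unfolding bohl_fun_def char_eval_def by (intro sum.cong refl arg_cong2[of _ _ _ _ "(*)"] const)
  then show ?thesis
    using trig_coefficient_le[OF finite_keys True, of "\<lambda>\<mu>. poly (Poly_Mapping.lookup P \<mu>) 0" M]
      bound bounded_bohl_fun_keys[OF bound] by auto
next
  case False
  then show ?thesis
    using order_trans[OF norm_ge_zero bound] by (simp add: in_keys_iff)
qed

text \<open>Linear independence of the functions \<open>t ^ m * exp (\<kappa> * t)\<close>: an identity between elements of the
  Bohl algebra is an identity in the group algebra, so that all characters preserve it.\<close>

lemma bohl_fun_eq_0D:
  assumes "\<And>t. bohl_fun P t = 0"
  shows "P = 0"
proof (rule ccontr)
  assume "P \<noteq> 0"
  then obtain \<kappa> where \<kappa>: "\<kappa> \<in> Poly_Mapping.keys P"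
    by (metis poly_mapping_eqI lookup_zero in_keys_iff)
  have "poly (Poly_Mapping.lookup P \<kappa>) 0 = 0"
    using bounded_bohl_fun_coefficient_le[of P 0 \<kappa>] assms by simp
  moreover have "degree (Poly_Mapping.lookup P \<kappa>) = 0"
    using bounded_bohl_fun_keys[of P 0 \<kappa>] assms \<kappa> by simp
  ultimately have "Poly_Mapping.lookup P \<kappa> = 0"
    by (metis degree_eq_zeroE poly_const_conv pCons_0_0)
  then show False using \<kappa> by (simp add: in_keys_iff)
qed

section \<open>Character values and the supremum norm\<close>

text \<open>Characters are evaluated with \<open>t = 0\<close>, where a polynomial coefficient contributes its constant term. For a trigonometric polynomial this is the \<open>\<ell>\<^sup>1\<close> norm.\<close>

definition coef_norm :: "exp_poly \<Rightarrow> real" where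
  "coef_norm P = (\<Sum>\<kappa>\<in>Poly_Mapping.keys P. cmod (poly (Poly_Mapping.lookup P \<kappa>) 0))"

lemma char_eval_le_coef_norm:
  assumes "\<And>\<kappa>. cmod (\<phi> \<kappa>) \<le> 1"
  shows "cmod (char_eval 0 \<phi> P) \<le> coef_norm P"
  unfolding char_eval_def coef_norm_def
  by (intro sum_norm_le) (simp add: norm_mult assms mult_left_le)

text \<open>A character that is bounded by one does not increase the supremum norm. The coefficients
  of \<open>P ^ k\<close> are at most \<open>M ^ k\<close>, so the \<open>k\<close>-th power of the left-hand side is at most \<open>M ^ k\<close>
  times the number of frequencies of \<open>P ^ k\<close>. That number grows polynomially, and its
  \<open>k\<close>-th root tends to \<open>1\<close>.\<close>

lemma char_eval_le_sup:
  assumes \<phi>: "character \<phi>" "\<And>\<kappa>. cmod (\<phi> \<kappa>) \<le> 1"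
    and bound: "\<And>t. cmod (bohl_fun P t) \<le> M"
  shows "cmod (char_eval 0 \<phi> P) \<le> M"
proof (rule ccontr)
  assume "\<not> ?thesis"
  then have less: "M < cmod (char_eval 0 \<phi> P)" by simp
  have M: "0 \<le> M" using order_trans[OF norm_ge_zero bound] .
  have nonzero: "char_eval 0 \<phi> P \<noteq> 0" using less M by auto
  define x where "x = M / cmod (char_eval 0 \<phi> P)"
  have x: "0 \<le> x" "x < 1" using less M by (auto simp: x_def divide_less_eq)
  let ?d = "card (Poly_Mapping.keys P)"
  have ge1: "1 \<le> real (k + 1) ^ ?d * x ^ k" for k
  proof -
    have "cmod (bohl_fun (P ^ k) t) \<le> M ^ k" for t
      using bound[of t] by (simp add: bohl_fun_def char_eval_power character_exp norm_power power_mono)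
    then have coef: "cmod (poly (Poly_Mapping.lookup (P ^ k) \<kappa>) 0) \<le> M ^ k" for \<kappa>
      by (rule bounded_bohl_fun_coefficient_le)
    have "cmod (char_eval 0 \<phi> P) ^ k = cmod (char_eval 0 \<phi> (P ^ k))"
      using \<phi> by (simp add: char_eval_power norm_power)
    also have "\<dots> \<le> coef_norm (P ^ k)"
      using \<phi>(2) by (rule char_eval_le_coef_norm)
    also have "\<dots> \<le> real (card (Poly_Mapping.keys (P ^ k))) * M ^ k"
      unfolding coef_norm_def using coef by (intro sum_bounded_above)
    also have "\<dots> \<le> real ((k + 1) ^ ?d) * M ^ k"
      using card_keys_power M by (intro mult_right_mono of_nat_mono) auto
    finally show ?thesis
      using less M nonzero
      by (simp add: x_def power_divide mult.commute le_divide_eq)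
  qed
  have "(\<lambda>k. real (k + 1) ^ ?d * x ^ k) \<longlonglongrightarrow> 0"
  proof (cases "x = 0")
    case True
    then show ?thesis
      by (intro tendsto_eventually eventually_mono[OF eventually_gt_at_top[of 0]]) simp
  next
    case False
    with x show ?thesis by real_asymp
  qed
  then have "1 \<le> (0 :: real)"
    by (rule LIMSEQ_le_const) (use ge1 in blast)
  then show False by simp
qed

text \<open>A Bezout identity survives the application of a character. The cofactors \<open>X j\<close> may be unbounded
  functions, but their values under a character that is bounded by one have bounds that do not depend
  on the character; so the values of \<open>G\<close> are bounded away from a common zero, uniformly in \<open>\<phi>\<close>.\<close>

lemma bezout_bounds_characters:
  assumes bezout: "\<And>t. (\<Sum>j\<in>J. bohl_fun (X j) t * bohl_fun (G j) t) = 1"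
    and \<phi>: "character \<phi>" "\<And>\<kappa>. cmod (\<phi> \<kappa>) \<le> 1"
  shows "1 \<le> (\<Sum>j\<in>J. coef_norm (X j) * cmod (char_eval 0 \<phi> (G j)))"
proof -
  have "bohl_fun ((\<Sum>j\<in>J. X j * G j) - 1) t = 0" for t
    using bezout[of t] unfolding bohl_fun_def
    by (simp add: char_eval_diff char_eval_sum char_eval_mult char_eval_one character_exp)
  then have "(\<Sum>j\<in>J. X j * G j) - 1 = 0"
    by (rule bohl_fun_eq_0D)
  then have "char_eval 0 \<phi> (\<Sum>j\<in>J. X j * G j) = 1"
    by (simp add: char_eval_one \<phi>)
  then have "1 = cmod (\<Sum>j\<in>J. char_eval 0 \<phi> (X j) * char_eval 0 \<phi> (G j))"
    by (simp add: char_eval_sum char_eval_mult \<phi>)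
  also have "\<dots> \<le> (\<Sum>j\<in>J. coef_norm (X j) * cmod (char_eval 0 \<phi> (G j)))"
    by (intro sum_norm_le) (auto simp: norm_mult intro!: mult_right_mono char_eval_le_coef_norm \<phi>)
  finally show ?thesis .
qed

section \<open>A torus of characters\<close>

text \<open>Coordinates with respect to a Hamel basis of \<open>\<real>\<close> over \<open>\<rat>\<close>, which is infinite because \<open>\<real>\<close>
  is uncountable; the \<open>\<alpha> j\<close> are distinct basis elements. The additivity of the coordinates on
  all of \<open>\<real>\<close> matters, since the frequencies of a perturbation are arbitrary.\<close>

lemma rational_coordinates_exist:
  "\<exists>(\<alpha> :: nat \<Rightarrow> real) (q :: nat \<Rightarrow> real \<Rightarrow> real).
     (\<forall>k x y. q k (x + y) = q k x + q k y) \<and> (\<forall>j k. q k (\<alpha> j) = (if j = k then 1 else 0))"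
proof -
  interpret Q: vector_space "\<lambda>(r :: rat) (x :: real). of_rat r * x"
    by standard (auto simp: algebra_simps of_rat_add of_rat_mult)
  obtain B where B: "Q.independent B" "Q.span B = UNIV"
    using Q.independent_extend_basis[OF Q.independent_empty] Q.span_extend_basis[OF Q.independent_empty] by blast
  have "infinite B"
  proof
    assume fin: "finite B"
    have "Q.span B = range (\<lambda>c. \<Sum>b\<in>B. of_rat (c b) * b)"
      by (rule Q.span_finite[OF fin])
    also have "\<dots> \<subseteq> (\<lambda>c. \<Sum>b\<in>B. of_rat (c b) * b) ` (B \<rightarrow>\<^sub>E UNIV)"
    proof (rule image_subsetI)
      fix c :: "real \<Rightarrow> rat"
      have eq: "(\<Sum>b\<in>B. of_rat (c b) * b) = (\<Sum>b\<in>B. of_rat (restrict c B b) * b)"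
        by (intro sum.cong) auto
      show "(\<Sum>b\<in>B. of_rat (c b) * b) \<in> (\<lambda>c. \<Sum>b\<in>B. of_rat (c b) * b) ` (B \<rightarrow>\<^sub>E UNIV)"
        by (rule image_eqI[where x = "restrict c B"]) (simp_all only: eq, simp)
    qed
    finally have "UNIV \<subseteq> (\<lambda>c. \<Sum>b\<in>B. of_rat (c b) * b) ` (B \<rightarrow>\<^sub>E (UNIV :: rat set))"
      unfolding B(2) .
    moreover have "countable \<dots>"
      by (intro countable_image countable_PiE fin) simp
    ultimately have "countable (UNIV :: real set)"
      by (rule countable_subset)
    then show False using uncountable_UNIV_real by blast
  qed
  then obtain \<alpha> :: "nat \<Rightarrow> real" where \<alpha>: "inj \<alpha>" "range \<alpha> \<subseteq> B"
    using infinite_countable_subset by blast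
  have \<alpha>_in: "\<alpha> j \<in> B" for j using \<alpha>(2) by blast
  define q where "q k x = real_of_rat (Q.representation B x (\<alpha> k))" for k x
  have "q k (x + y) = q k x + q k y" for k x y
    using Q.representation_add[OF B(1)] B(2) by (simp add: q_def of_rat_add)
  moreover have "q k (\<alpha> j) = (if j = k then 1 else 0)" for j k
    using Q.representation_basis[OF B(1) \<alpha>_in[of j]] \<alpha>(1) by (auto simp: q_def inj_eq)
  ultimately show ?thesis by blast
qed

text \<open>An \<open>N\<close>-parameter family of characters, obtained by letting the phases of the independent
  frequencies \<open>\<alpha> k\<close> vary independently. The coordinates of the imaginary part extend these
  characters from the imaginary axis to \<open>\<complex>\<close>, where the cofactors of a Bezout identity have
  their frequencies.\<close>

definition torus_char :: "(nat \<Rightarrow> real \<Rightarrow> real) \<Rightarrow> nat \<Rightarrow> (nat \<Rightarrow> real) \<Rightarrow> complex \<Rightarrow> complex" where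
  "torus_char q N \<theta> \<kappa> = cis (\<Sum>k<N. \<theta> k * q k (Im \<kappa>))"

lemma norm_torus_char: "cmod (torus_char q N \<theta> \<kappa>) = 1"
  by (simp add: torus_char_def)

lemma character_torus_char:
  assumes "\<And>k x y. q k (x + y) = q k x + q k y"
  shows "character (torus_char q N \<theta>)"
proof -
  have "q k 0 = 0" for k using assms[of k 0 0] by simp
  then show ?thesis
    by (simp add: character_def torus_char_def assms cis_mult distrib_left sum.distrib)
qed

lemma norm_cis_diff_le: "cmod (cis x - cis y) \<le> \<bar>x - y\<bar>"
proof -
  have "cmod (cis x - cis y) = cmod (cis y * (cis (x - y) - 1))"
    by (simp add: right_diff_distrib cis_mult)
  also have "\<dots> = cmod (exp (\<i> * of_real (x - y)) - 1)"
    by (simp add: norm_mult cis_conv_exp)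
  also have "\<dots> = 2 * \<bar>sin ((x - y) / 2)\<bar>"
    by (rule dist_exp_i_1)
  also have "\<dots> \<le> \<bar>x - y\<bar>"
    using abs_sin_x_le_abs_x[of "(x - y) / 2"] by simp
  finally show ?thesis .
qed

text \<open>A Lipschitz constant, with respect to the maximum norm of the phases, of the value at \<open>P\<close>.\<close>

definition torus_lipschitz :: "(nat \<Rightarrow> real \<Rightarrow> real) \<Rightarrow> nat \<Rightarrow> exp_poly \<Rightarrow> real" where
  "torus_lipschitz q N P = (\<Sum>\<kappa>\<in>Poly_Mapping.keys P.
     cmod (poly (Poly_Mapping.lookup P \<kappa>) 0) * (\<Sum>k<N. \<bar>q k (Im \<kappa>)\<bar>))"

lemma char_eval_torus_char_lipschitz:
  assumes "\<And>k. k < N \<Longrightarrow> \<bar>u k - v k\<bar> \<le> \<eta>"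
  shows "cmod (char_eval 0 (torus_char q N u) P - char_eval 0 (torus_char q N v) P)
           \<le> torus_lipschitz q N P * \<eta>"
proof -
  have "cmod (torus_char q N u \<kappa> - torus_char q N v \<kappa>) \<le> (\<Sum>k<N. \<bar>q k (Im \<kappa>)\<bar>) * \<eta>" for \<kappa>
  proof -
    have "cmod (torus_char q N u \<kappa> - torus_char q N v \<kappa>)
        \<le> \<bar>(\<Sum>k<N. u k * q k (Im \<kappa>)) - (\<Sum>k<N. v k * q k (Im \<kappa>))\<bar>"
      unfolding torus_char_def by (rule norm_cis_diff_le)
    also have "\<dots> = \<bar>\<Sum>k<N. (u k - v k) * q k (Im \<kappa>)\<bar>"
      by (simp add: sum_subtractf left_diff_distrib)
    also have "\<dots> \<le> (\<Sum>k<N. \<bar>(u k - v k) * q k (Im \<kappa>)\<bar>)"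
      by (rule sum_abs)
    also have "\<dots> \<le> (\<Sum>k<N. \<bar>q k (Im \<kappa>)\<bar> * \<eta>)"
      using assms by (intro sum_mono) (simp add: abs_mult mult.commute[of "\<bar>u _ - v _\<bar>"] mult_left_mono)
    finally show ?thesis by (simp add: sum_distrib_right)
  qed
  then have "cmod (\<Sum>\<kappa>\<in>Poly_Mapping.keys P. poly (Poly_Mapping.lookup P \<kappa>) 0 * (torus_char q N u \<kappa> - torus_char q N v \<kappa>))
      \<le> (\<Sum>\<kappa>\<in>Poly_Mapping.keys P. cmod (poly (Poly_Mapping.lookup P \<kappa>) 0) * ((\<Sum>k<N. \<bar>q k (Im \<kappa>)\<bar>) * \<eta>))"
    by (intro sum_norm_le) (simp add: norm_mult mult_left_mono)
  then show ?thesis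
    by (simp add: char_eval_def torus_lipschitz_def sum_subtractf right_diff_distrib sum_distrib_right mult.assoc)
qed

section \<open>Stable zeros of the sine tuple\<close>

text \<open>The Poincare-Miranda theorem, a form of Brouwer's theorem, with an approximate zero. The dimension
  \<open>N\<close> is a number and not a type, as the length of tuples is quantified later. Kuhn's lemma is
  applied to a fine grid labelled by the signs of the \<open>G i\<close>: it gives a grid cell in which every
  \<open>G i\<close> changes sign.\<close>

lemma poincare_miranda_approx:
  fixes G :: "nat \<Rightarrow> (nat \<Rightarrow> real) \<Rightarrow> real"
  fixes a b K \<delta> :: real and N :: nat
  defines "cube \<equiv> {u. \<forall>j<N. a \<le> u j \<and> u j \<le> b}"
  assumes "a < b" and "0 < \<delta>"
    and lower: "\<And>i u. i < N \<Longrightarrow> u \<in> cube \<Longrightarrow> u i = a \<Longrightarrow> G i u < 0"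
    and upper: "\<And>i u. i < N \<Longrightarrow> u \<in> cube \<Longrightarrow> u i = b \<Longrightarrow> 0 \<le> G i u"
    and lipschitz: "\<And>i u v \<eta>. i < N \<Longrightarrow> \<forall>j<N. \<bar>u j - v j\<bar> \<le> \<eta> \<Longrightarrow> \<bar>G i u - G i v\<bar> \<le> K * \<eta>"
  shows "\<exists>u\<in>cube. \<forall>i<N. \<bar>G i u\<bar> \<le> \<delta>"
proof -
  obtain p :: nat where p: "p > 0" "K * (b - a) / \<delta> < p"
    by (metis gr0I not_gr_zero of_nat_0_less_iff order.strict_trans reals_Archimedean2 max_less_iff_conj)
  define pt where "pt x j = a + (b - a) * real (x j) / real p" for x :: "nat \<Rightarrow> nat" and j :: nat
  define label where "label x i = (if 0 \<le> G i (pt x) then 1 else 0 :: nat)" for x i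
  have pt_cube: "pt x \<in> cube" if "\<forall>j<N. x j \<le> p" for x
  proof -
    have "(b - a) * real (x j) \<le> (b - a) * real p" if "j < N" for j
      using \<open>a < b\<close> \<open>\<forall>j<N. x j \<le> p\<close> that by (intro mult_left_mono) auto
    then show ?thesis
      using \<open>a < b\<close> p by (auto simp: cube_def pt_def divide_simps algebra_simps mult_right_mono)
  qed
  have label_0: "\<forall>x. (\<forall>i<N. x i \<le> p) \<longrightarrow> (\<forall>i<N. x i = 0 \<longrightarrow> label x i = 0)"
  proof (intro allI impI)
    fix x i assume x: "\<forall>i<N. x i \<le> p" and i: "i < N" "x i = 0"
    show "label x i = 0"
      using lower[OF i(1) pt_cube[OF x]] i by (simp add: label_def pt_def)
  qed
  have label_p: "\<forall>x. (\<forall>i<N. x i \<le> p) \<longrightarrow> (\<forall>i<N. x i = p \<longrightarrow> label x i = 1)"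
    using upper[OF _ pt_cube] p by (auto simp: label_def pt_def)
  have label_01: "\<forall>x. (\<forall>i<N. x i \<le> p) \<longrightarrow> (\<forall>i<N. label x i = 0 \<or> label x i = 1)"
    by (simp add: label_def)
  obtain q where q: "\<forall>i<N. q i < p"
    and cell: "\<forall>i<N. \<exists>r s. (\<forall>j<N. q j \<le> r j \<and> r j \<le> q j + 1) \<and>
      (\<forall>j<N. q j \<le> s j \<and> s j \<le> q j + 1) \<and> label r i \<noteq> label s i"
    by (rule kuhn_lemma[OF p(1) label_01 label_0 label_p])
  have near: "\<bar>G i (pt q) - G i (pt r)\<bar> \<le> \<delta>"
    if "i < N" and r: "\<forall>j<N. q j \<le> r j \<and> r j \<le> q j + 1" for i r
  proof -
    have "\<bar>pt q j - pt r j\<bar> \<le> (b - a) / p" if "j < N" for j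
    proof -
      have "r j = q j \<or> r j = q j + 1" using r that by force
      then have "\<bar>real (q j) - real (r j)\<bar> \<le> 1" by auto
      moreover have "pt q j - pt r j = (b - a) / p * (real (q j) - real (r j))"
        by (simp add: pt_def diff_divide_distrib[symmetric] right_diff_distrib)
      ultimately show ?thesis
        using \<open>a < b\<close> by (simp add: abs_mult divide_right_mono mult_left_le)
    qed
    then have "\<bar>G i (pt q) - G i (pt r)\<bar> \<le> K * ((b - a) / p)"
      using lipschitz \<open>i < N\<close> by blast
    also have "\<dots> \<le> \<delta>" using p \<open>0 < \<delta>\<close> by (simp add: field_simps)
    finally show ?thesis .
  qed
  have "\<bar>G i (pt q)\<bar> \<le> \<delta>" if i: "i < N" for i
  proof -
    obtain r s where rs: "\<forall>j<N. q j \<le> r j \<and> r j \<le> q j + 1" "\<forall>j<N. q j \<le> s j \<and> s j \<le> q j + 1"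
      "label r i \<noteq> label s i" using mp[OF spec[OF cell] i] by (elim exE conjE) (rule that)
    show ?thesis
      using near[OF i rs(1)] near[OF i rs(2)] rs(3) by (simp add: label_def split: if_splits)
  qed
  moreover have "pt q \<in> cube" using q by (intro pt_cube) auto
  ultimately show ?thesis by blast
qed

text \<open>The function \<open>sin (a * t) + \<i> * sin (b * t)\<close>.\<close>

definition sine_pair :: "real \<Rightarrow> real \<Rightarrow> exp_poly" where
  "sine_pair a b = Poly_Mapping.single (\<i> * of_real a) [:- \<i> / 2:] + Poly_Mapping.single (- \<i> * of_real a) [:\<i> / 2:]
     + Poly_Mapping.single (\<i> * of_real b) [:1 / 2:] + Poly_Mapping.single (- \<i> * of_real b) [:- 1 / 2:]"

lemma char_eval_sine_pair:
  assumes add: "\<And>k x y. q k (x + y) = q k x + q k y"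
    and coord: "\<And>j k. q k (\<alpha> j) = (if j = k then 1 else 0)" and "i < N" "j < N"
  shows "char_eval 0 (torus_char q N \<theta>) (sine_pair (\<alpha> i) (\<alpha> j)) = Complex (sin (\<theta> i)) (sin (\<theta> j))"
proof -
  have "q k 0 = 0" for k using add[of k 0 0] by simp
  then have neg: "q k (- x) = - q k x" for k x
    using add[of k x "- x"] by simp
  have "torus_char q N \<theta> (\<i> * of_real (\<alpha> l)) = cis (\<theta> l)"
    "torus_char q N \<theta> (- \<i> * of_real (\<alpha> l)) = cis (- \<theta> l)" if "l < N" for l
    using that by (simp_all add: torus_char_def neg coord sum_negf if_distrib cong: if_cong)
  then show ?thesis
    using assms(3,4) by (simp add: sine_pair_def char_eval_add complex_eq_iff)
qed

text \<open>Under the character with phases \<open>\<theta>\<close>, the real and imaginary parts of the values of \<open>G\<close>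
  differ by at most \<open>1 / 2\<close> from the coordinates \<open>sin (\<theta> i)\<close>. Those change sign between opposite
  faces of the cube with \<open>\<bar>\<theta> i\<bar> \<le> pi / 2\<close>, where they are \<open>-1\<close> and \<open>1\<close>. So some character makes
  all values of \<open>G\<close> as small as desired, against \<open>bezout_bounds_characters\<close>.\<close>

lemma perturbed_sines_satisfy_no_bezout:
  fixes \<alpha> :: "nat \<Rightarrow> real" and q :: "nat \<Rightarrow> real \<Rightarrow> real"
  assumes add: "\<And>k x y. q k (x + y) = q k x + q k y"
    and coord: "\<And>j k. q k (\<alpha> j) = (if j = k then 1 else 0)"
    and near: "\<And>j t. j < n \<Longrightarrow>
        cmod (bohl_fun (G j) t - bohl_fun (sine_pair (\<alpha> (2 * j)) (\<alpha> (2 * j + 1))) t) \<le> 1 / 2"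
    and bezout: "\<And>t. (\<Sum>j<n. bohl_fun (X j) t * bohl_fun (G j) t) = 1"
  shows False
proof -
  define N where "N = 2 * n"
  define S where "S j = sine_pair (\<alpha> (2 * j)) (\<alpha> (2 * j + 1))" for j
  define part where "part i w = (if even i then Re w else Im w)" for i :: nat and w :: complex
  define ev where "ev \<theta> P = char_eval 0 (torus_char q N \<theta>) P" for \<theta> P
  \<comment> \<open>Coordinates \<open>2 * j\<close> and \<open>2 * j + 1\<close> are the real and imaginary part of the \<open>j\<close>-th entry.\<close>
  define F where "F i \<theta> = part i (ev \<theta> (G (i div 2)))" for i \<theta>
  have part_le: "\<bar>part i w\<bar> \<le> cmod w"
    and part_diff: "part i (w - z) = part i w - part i z" for i w z
    by (auto simp: part_def abs_Re_le_cmod abs_Im_le_cmod)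
  have half: "i div 2 < n" if "i < N" for i
    using that by (simp add: N_def less_mult_imp_div_less mult.commute)
  have F_sine: "\<bar>F i \<theta> - sin (\<theta> i)\<bar> \<le> 1 / 2" if i: "i < N" for i \<theta>
  proof -
    have "ev \<theta> (S (i div 2)) = Complex (sin (\<theta> (2 * (i div 2)))) (sin (\<theta> (2 * (i div 2) + 1)))"
      using half[OF i] unfolding ev_def S_def
      by (intro char_eval_sine_pair add coord) (auto simp: N_def)
    then have "part i (ev \<theta> (S (i div 2))) = sin (\<theta> i)"
      by (cases "even i") (auto simp: part_def)
    moreover have "cmod (ev \<theta> (G (i div 2) - S (i div 2))) \<le> 1 / 2"
      unfolding ev_def
    proof (rule char_eval_le_sup)
      show "cmod (bohl_fun (G (i div 2) - S (i div 2)) t) \<le> 1 / 2" for t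
        using near[OF half[OF i], of t] by (simp add: S_def bohl_fun_def char_eval_diff)
    qed (simp_all add: character_torus_char add norm_torus_char)
    ultimately show ?thesis
      using part_le[of i "ev \<theta> (G (i div 2) - S (i div 2))"]
      by (simp add: F_def ev_def char_eval_diff part_diff)
  qed
  define C where "C = (\<Sum>j<n. coef_norm (X j))"
  have C: "C \<ge> 0" "\<And>j. coef_norm (X j) \<ge> 0"
    by (simp_all add: C_def coef_norm_def sum_nonneg)
  \<comment> \<open>Entries of modulus at most \<open>2 * \<delta>\<close> are too small for the lower bound: \<open>C * (2 * \<delta>) < 1\<close>.\<close>
  define \<delta> where "\<delta> = 1 / (4 * (1 + C))"
  define K where "K = (\<Sum>j<n. torus_lipschitz q N (G j))"
  have lipschitz: "\<bar>F i u - F i v\<bar> \<le> K * \<eta>" if i: "i < N" and uv: "\<forall>j<N. \<bar>u j - v j\<bar> \<le> \<eta>" for i u v \<eta>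
  proof -
    have "\<eta> \<ge> 0" using uv i by (meson abs_ge_zero order_trans)
    have "\<bar>F i u - F i v\<bar> \<le> cmod (ev u (G (i div 2)) - ev v (G (i div 2)))"
      using part_le by (simp add: F_def part_diff[symmetric])
    also have "\<dots> \<le> torus_lipschitz q N (G (i div 2)) * \<eta>"
      unfolding ev_def using uv by (intro char_eval_torus_char_lipschitz) auto
    also have "\<dots> \<le> K * \<eta>"
      unfolding K_def using half[OF i] \<open>\<eta> \<ge> 0\<close>
      by (intro mult_right_mono member_le_sum) (auto simp: torus_lipschitz_def intro!: sum_nonneg mult_nonneg_nonneg)
    finally show ?thesis .
  qed
  have "\<exists>\<theta>\<in>{u. \<forall>j<N. - (pi / 2) \<le> u j \<and> u j \<le> pi / 2}. \<forall>i<N. \<bar>F i \<theta>\<bar> \<le> \<delta>"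
  proof (rule poincare_miranda_approx)
    show "F i u < 0" if "i < N" "u i = - (pi / 2)" for i u
    proof -
      have "sin (u i) = - 1" by (simp add: that(2))
      then show ?thesis using F_sine[OF that(1), of u] by linarith
    qed
    show "0 \<le> F i u" if "i < N" "u i = pi / 2" for i u
    proof -
      have "sin (u i) = 1" by (simp add: that(2))
      then show ?thesis using F_sine[OF that(1), of u] by linarith
    qed
  qed (use C lipschitz in \<open>auto simp: \<delta>_def\<close>)
  then obtain \<theta> where \<theta>: "\<And>i. i < N \<Longrightarrow> \<bar>F i \<theta>\<bar> \<le> \<delta>"
    by blast
  have small: "cmod (ev \<theta> (G j)) \<le> 2 * \<delta>" if "j < n" for j
  proof -
    have "\<bar>Re (ev \<theta> (G j))\<bar> \<le> \<delta>" "\<bar>Im (ev \<theta> (G j))\<bar> \<le> \<delta>"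
      using \<theta>[of "2 * j"] \<theta>[of "2 * j + 1"] that by (simp_all add: F_def part_def N_def)
    then show ?thesis using cmod_le[of "ev \<theta> (G j)"] by simp
  qed
  have "1 \<le> (\<Sum>j<n. coef_norm (X j) * cmod (ev \<theta> (G j)))"
    unfolding ev_def by (intro bezout_bounds_characters bezout character_torus_char add) (simp add: norm_torus_char)
  also have "\<dots> \<le> (\<Sum>j<n. coef_norm (X j) * (2 * \<delta>))"
    using small C by (intro sum_mono mult_left_mono) auto
  also have "\<dots> = C * (2 * \<delta>)"
    by (simp add: C_def sum_distrib_right)
  also have "\<dots> < 1"
    using C(1) by (simp add: \<delta>_def field_simps)
  finally show False by simp
qed

section \<open>Non-density of invertible tuples\<close>

lemma unif_ball_cmod_le:
  assumes "g \<in> unif_ball f e"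
  shows "cmod (f t - g t) \<le> e"
proof -
  have "ereal (cmod (f t - g t)) \<le> (SUP t. ereal (cmod (f t - g t)))"
    by (rule SUP_upper) simp
  also have "\<dots> < ereal e"
    using assms by (simp add: unif_ball_def)
  finally show ?thesis by simp
qed

lemma finsum_bohl_ring:
  assumes "finite A" "\<And>j. j \<in> A \<Longrightarrow> F j \<in> bohl"
  shows "finsum bohl_ring F A = (\<lambda>t. \<Sum>j\<in>A. F j t)"
proof -
  interpret B: cring bohl_ring by (rule cring_bohl_ring)
  show ?thesis
    using assms
  proof (induction A rule: finite_induct)
    case empty
    have "\<zero>\<^bsub>bohl_ring\<^esub> = (\<lambda>t. 0)" by (simp add: bohl_ring_def)
    then show ?case by simp
  next
    case (insert a A)
    have "finsum bohl_ring F (insert a A) = F a \<oplus>\<^bsub>bohl_ring\<^esub> finsum bohl_ring F A"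
      using insert by (intro B.finsum_insert) (auto simp: bohl_ring_def)
    moreover have "f \<oplus>\<^bsub>bohl_ring\<^esub> g = (\<lambda>t. f t + g t)" for f g
      by (simp add: bohl_ring_def)
    ultimately show ?case using insert by simp
  qed
qed

text \<open>The tuple of \<open>n\<close> sine pairs with \<open>2 * n\<close> rationally independent frequencies has a neighbourhood
  without invertible tuples.\<close>

lemma bohl_not_dense_invertible_tuples:
  "product_topology (\<lambda>_. bohl_topology) {1..n} closure_of invertible_tuples bohl_ring n
     \<noteq> ({1..n} \<rightarrow>\<^sub>E carrier bohl_ring)"
proof
  assume dense: "product_topology (\<lambda>_. bohl_topology) {1..n} closure_of invertible_tuples bohl_ring n
     = ({1..n} \<rightarrow>\<^sub>E carrier bohl_ring)"
  obtain \<alpha> :: "nat \<Rightarrow> real" and q :: "nat \<Rightarrow> real \<Rightarrow> real"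
    where add: "\<And>k x y. q k (x + y) = q k x + q k y"
      and coord: "\<And>j k. q k (\<alpha> j) = (if j = k then 1 else 0)"
    using rational_coordinates_exist by blast
  define f where "f j = bohl_fun (sine_pair (\<alpha> (2 * (j - 1))) (\<alpha> (2 * (j - 1) + 1)))" for j
  define W where "W = (\<Pi>\<^sub>E j\<in>{1..n}. unif_ball (f j) (1 / 2))"
  have f: "f j \<in> bohl" for j
    by (simp add: f_def bohl_fun_in_bohl)
  have "openin bohl_topology (unif_ball (f j) (1 / 2))" for j
    unfolding bohl_topology_def by (rule topology_generated_by_Basis) (use f in fastforce)
  then have "openin (product_topology (\<lambda>_. bohl_topology) {1..n}) W"
    by (simp add: W_def openin_PiE)
  moreover have "restrict f {1..n} \<in> W"
    by (simp add: W_def unif_ball_centre f)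
  moreover have "restrict f {1..n} \<in> {1..n} \<rightarrow>\<^sub>E carrier bohl_ring"
    by (simp add: bohl_ring_def f)
  ultimately obtain g where g: "g \<in> invertible_tuples bohl_ring n" "g \<in> W"
    unfolding dense[symmetric] in_closure_of by blast
  have carrier: "carrier bohl_ring = bohl" and mult: "x \<otimes>\<^bsub>bohl_ring\<^esub> y = (\<lambda>t. x t * y t)"
    and one: "\<one>\<^bsub>bohl_ring\<^esub> = (\<lambda>t. 1)" for x y
    by (simp_all add: bohl_ring_def)
  obtain x where x: "x \<in> {1..n} \<rightarrow>\<^sub>E bohl"
    and xg: "finsum bohl_ring (\<lambda>j t. x j t * g j t) {1..n} = (\<lambda>t. 1)"
    using g(1) unfolding invertible_tuples_def carrier mult one by blast
  have g_in: "g \<in> {1..n} \<rightarrow>\<^sub>E bohl"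
    using g(1) by (simp add: invertible_tuples_def carrier)
  have "\<forall>j\<in>{1..n}. \<exists>P. bohl_fun P = x j" "\<forall>j\<in>{1..n}. \<exists>P. bohl_fun P = g j"
    using x g_in by (meson PiE_mem bohl_obtain_exp_poly)+
  then obtain X G where X: "\<And>j. j \<in> {1..n} \<Longrightarrow> bohl_fun (X j) = x j"
    and G: "\<And>j. j \<in> {1..n} \<Longrightarrow> bohl_fun (G j) = g j"
    by metis
  have "finsum bohl_ring (\<lambda>j t. x j t * g j t) {1..n} = (\<lambda>t. \<Sum>j\<in>{1..n}. x j t * g j t)"
    using x g_in by (intro finsum_bohl_ring bohl_mult) auto
  then have bezout: "(\<Sum>j\<in>{1..n}. x j t * g j t) = 1" for t
    using xg by (metis (no_types))
  show False
  proof (rule perturbed_sines_satisfy_no_bezout[OF add coord])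
    show "cmod (bohl_fun (G (Suc j)) t - bohl_fun (sine_pair (\<alpha> (2 * j)) (\<alpha> (2 * j + 1))) t) \<le> 1 / 2"
      if "j < n" for j t
    proof -
      have "g (Suc j) \<in> unif_ball (f (Suc j)) (1 / 2)"
        using g(2) that by (auto simp: W_def PiE_iff)
      from unif_ball_cmod_le[OF this, of t] show ?thesis
        using that by (simp add: G f_def norm_minus_commute)
    qed
    show "(\<Sum>j<n. bohl_fun (X (Suc j)) t * bohl_fun (G (Suc j)) t) = 1" for t
    proof -
      have "(\<Sum>j<n. bohl_fun (X (Suc j)) t * bohl_fun (G (Suc j)) t) = (\<Sum>j<n. x (Suc j) t * g (Suc j) t)"
        by (intro sum.cong) (auto simp: X G)
      also have "\<dots> = (\<Sum>j\<in>{1..n}. x j t * g j t)"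
        by (rule sum.reindex_bij_witness[of _ "\<lambda>j. j - 1" Suc]) auto
      finally show ?thesis using bezout by simp
    qed
  qed
qed

theorem theorem1p5:
  shows "topological_stable_rank bohl_ring bohl_topology = \<infinity>"
proof -
  have "{enat n | n. n \<ge> 1 \<and> product_topology (\<lambda>_. bohl_topology) {1..n} closure_of
      invertible_tuples bohl_ring n = ({1..n} \<rightarrow>\<^sub>E carrier bohl_ring)} = {}"
    using bohl_not_dense_invertible_tuples by blast
  then show ?thesis
    unfolding topological_stable_rank_def by (simp only: Inf_empty top_enat_def)
qed

end
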